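(* Let $(\Omega,\mathcal F,(\mathcal F_n)_{n=0,1,2,\dots})$ be a discrete-time filtered space with $\mathcal F=\bigvee_n\mathcal F_n$, let $\mu,P$ be probability measures on it with $\mu\ll P$, let $z$ be the density process of $\mu$ with respect to $P$, and let $T$ be a stopping time. Then, $P$-a.s., $$\mathbf E_P[z_T|\mathcal F_{T-}]=\begin{cases}z_T,&\omega\in\{T=0\}\cup\{T=\infty\},\\[4pt]\dfrac{\mathbf E_P\big[z_n1_{\{T=n\}}\big|\mathcal F_{n-1}\big]}{\mathbf E_P\big[1_{\{T=n\}}\big|\mathcal F_{n-1}\big]},&\omega\in\{T=n\},\ n\ge1.\end{cases}$$
   Context: $T$ takes values in $\{0,1,2,\dots\}\cup\{\infty\}$. $\mathcal F_{T-}$ is the $\sigma$-algebra generated by $\mathcal F_0$ and the sets $A\cap\{n<T\}$, $A\in\mathcal F_n$, $n\ge0$. $z_n=d\mu_n/dP_n$ (restrictions to $\mathcal F_n$) and $z_\infty=d\mu/dP$. *)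

theory Defs
  imports "HOL-Probability.Probability"
begin

text \<open>
  The filtration extended to the index set \<open>{0, 1, 2, \<dots>} \<union> {\<infinity>}\<close> by
  \<open>\<F>\<^sub>\<infinity> = \<Or>\<^sub>n \<F>\<^sub>n\<close>, so that times with values in \<^typ>\<open>enat\<close> can be related to it. Since
  \<open>{T \<le> \<infinity>}\<close> is the whole space, \<open>stopping_time (extended_filtration \<Omega> F) T\<close> amounts to
  \<open>{T \<le> n} \<in> \<F>\<^sub>n\<close> for all finite \<open>n\<close>.
\<close>

definition extended_filtration :: "'a set \<Rightarrow> (nat \<Rightarrow> 'a measure) \<Rightarrow> enat \<Rightarrow> 'a measure" where
  "extended_filtration \<Omega> F t =
    (case t of enat n \<Rightarrow> F n | \<infinity> \<Rightarrow> sigma \<Omega> (\<Union>n. sets (F n)))"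

definition strict_past :: "'a set \<Rightarrow> (nat \<Rightarrow> 'a measure) \<Rightarrow> ('a \<Rightarrow> enat) \<Rightarrow> 'a measure" where
  "strict_past \<Omega> F T =
    sigma \<Omega> (sets (F 0) \<union> {A \<inter> {\<omega> \<in> \<Omega>. enat n < T \<omega>} | A n. A \<in> sets (F n)})"

text \<open>
  Densities are determined only up to null sets, so this is a predicate: each \<open>z n\<close> may be any real,
  \<open>\<F>\<^sub>n\<close>-measurable version of \<open>d\<mu>\<^sub>n/dP\<^sub>n\<close>, and \<open>z \<infinity>\<close> any version of \<open>d\<mu>/dP\<close>.
\<close>

definition density_process ::
  "'a measure \<Rightarrow> 'a measure \<Rightarrow> (nat \<Rightarrow> 'a measure) \<Rightarrow> (enat \<Rightarrow> 'a \<Rightarrow> real) \<Rightarrow> bool" where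
  "density_process P \<mu> F z \<longleftrightarrow>
    (\<forall>n. z (enat n) \<in> borel_measurable (F n) \<and>
      (AE \<omega> in restr_to_subalg P (F n).
        z (enat n) \<omega> = enn2real (RN_deriv (restr_to_subalg P (F n)) (restr_to_subalg \<mu> (F n)) \<omega>))) \<and>
    z \<infinity> \<in> borel_measurable P \<and>
    (AE \<omega> in P. z \<infinity> \<omega> = enn2real (RN_deriv P \<mu> \<omega>))"

text \<open>
  A conditional probability of \<open>B\<close> is almost surely positive on \<open>B\<close>, so a quotient with this denominator
  does not involve the convention \<open>x / 0 = 0\<close> there.
\<close>

lemma cond_prob_pos:
  assumes P: "prob_space P" and G: "subalgebra P G" and B: "B \<in> sets P"
  shows "AE \<omega> in P. \<omega> \<in> B \<longrightarrow> 0 < real_cond_exp P G (indicator B) \<omega>"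
proof -
  interpret prob_space P by (fact P)
  interpret finite_measure_subalgebra P G by unfold_locales (fact G)
  let ?e = "real_cond_exp P G (indicator B)"
  define N where "N = {\<omega> \<in> space G. ?e \<omega> \<le> 0}"
  have NG: "N \<in> sets G" unfolding N_def by measurable
  have NP: "N \<in> sets P" using NG G by (auto simp: subalgebra_def)
  have intB: "integrable P (indicator B :: _ \<Rightarrow> real)" using B by (simp add: emeasure_eq_measure)
  have nn: "AE \<omega> in P. 0 \<le> ?e \<omega>"
    using B by (intro real_cond_exp_pos) auto
  have "(\<integral>\<omega>\<in>N. indicator B \<omega> \<partial>P) = (\<integral>\<omega>\<in>N. ?e \<omega> \<partial>P)"
    by (rule real_cond_exp_intA[OF intB NG])
  also have "\<dots> = (\<integral>\<omega>. 0 \<partial>P)"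
    unfolding set_lebesgue_integral_def
  proof (rule integral_cong_AE)
    show "(\<lambda>\<omega>. indicator N \<omega> *\<^sub>R ?e \<omega>) \<in> borel_measurable P"
      using NP by measurable
    show "AE \<omega> in P. indicator N \<omega> *\<^sub>R ?e \<omega> = 0"
      using nn by eventually_elim (auto simp: N_def indicator_def)
  qed simp
  finally have "(\<integral>\<omega>. indicator (N \<inter> B) \<omega> \<partial>P) = (0::real)"
    by (simp add: set_lebesgue_integral_def indicator_inter_arith)
  hence "measure P (N \<inter> B) = 0" using NP B by (simp add: Int_absorb2 sets.sets_into_space)
  hence "N \<inter> B \<in> null_sets P" using NP B by (auto simp: null_sets_def emeasure_eq_measure)
  hence "AE \<omega> in P. \<omega> \<notin> N \<inter> B" by (rule AE_not_in)
  moreover have sp: "space G = space P" using G by (simp add: subalgebra_def)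
  ultimately show ?thesis using AE_space by eventually_elim (auto simp: N_def sp)
qed

end

theory Submission
  imports Defs
begin

text \<open>
  On \<open>{T = n}\<close> with \<open>n \<ge> 1\<close> the \<open>\<sigma>\<close>-algebra \<open>\<F>\<^sub>T\<^sub>-\<close> has the same trace as \<open>\<F>\<^sub>n\<^sub>-\<^sub>1\<close>, and whenever
  two \<open>\<sigma>\<close>-algebras \<open>\<G>\<close>, \<open>\<H>\<close> have the same trace on a set \<open>D \<in> \<G>\<close>, the conditional expectation
  of \<open>X\<close> given \<open>\<G>\<close> is on \<open>D\<close> given by Bayes' formula \<open>E[X 1\<^sub>D | \<H>] / E[1\<^sub>D | \<H>]\<close>. On \<open>{T = 0}\<close> and
  \<open>{T = \<infinity>}\<close> the traces of \<open>\<F>\<^sub>0\<close> and \<open>\<F>\<close> are contained in \<open>\<F>\<^sub>T\<^sub>-\<close>, so \<open>z\<^sub>T\<close> is already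
  \<open>\<F>\<^sub>T\<^sub>-\<close>-measurable there. Finally \<open>z\<^sub>T\<close> is integrable because the integral of \<open>z\<^sub>n\<close> over
  \<open>{T = n}\<close> is \<open>\<mu>{T = n}\<close>, also for \<open>n = \<infinity>\<close>, and these numbers add up to at most \<open>1\<close>.
\<close>

section \<open>Conditional expectations and traces of \<open>\<sigma>\<close>-algebras\<close>

lemma borel_measurable_mult_indicator_trace:
  fixes f :: "'a \<Rightarrow> real"
  assumes f: "f \<in> borel_measurable H" and sp: "space G = space H" and D: "D \<in> sets G"
    and tr: "\<And>A. A \<in> sets H \<Longrightarrow> A \<inter> D \<in> sets G"
  shows "(\<lambda>x. f x * indicator D x) \<in> borel_measurable G"
proof -
  have "(\<lambda>x. if x \<in> D then f x else 0) \<in> borel_measurable G"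
  proof (rule measurableI)
    fix S :: "real set" assume S: "S \<in> sets borel"
    have 1: "(f -` S \<inter> space H) \<inter> D \<in> sets G"
      by (rule tr) (rule measurable_sets[OF f S])
    have "(\<lambda>x. if x \<in> D then f x else 0) -` S \<inter> space G =
       ((f -` S \<inter> space H) \<inter> D) \<union> (if 0 \<in> S then space G - D else {})"
      using sets.sets_into_space[OF D] sp by (auto split: if_splits)
    also have "\<dots> \<in> sets G" using 1 D by auto
    finally show "(\<lambda>x. if x \<in> D then f x else 0) -` S \<inter> space G \<in> sets G" .
  qed simp
  moreover have "(\<lambda>x. if x \<in> D then f x else 0) = (\<lambda>x. f x * indicator D x)"
    by (auto simp: indicator_def)
  ultimately show ?thesis by simp
qed

text \<open>\<open>real_cond_exp\<close> is built from the positive and negative parts through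
  \<open>enn2real\<close>. For an indicator the negative part vanishes and the positive part is at
  most 1, so no infinite value is lost in the conversion. This allows nonnegative factors to be
  handled before their integrability is known.\<close>

lemma (in finite_measure_subalgebra) nn_cond_exp_indicator:
  assumes B: "B \<in> sets M"
  shows "AE x in M. nn_cond_exp M F (indicator B) x = ennreal (real_cond_exp M F (indicator B) x)"
proof -
  have "AE x in M. nn_cond_exp M F (indicator B) x \<le> nn_cond_exp M F (\<lambda>_. 1) x"
    using B by (intro nn_cond_exp_mono) (auto simp: indicator_def)
  moreover have "AE x in M. (1::ennreal) = nn_cond_exp M F (\<lambda>_. 1) x"
    by (rule nn_cond_exp_F_meas) simp
  moreover have "AE x in M. (0::ennreal) = nn_cond_exp M F (\<lambda>_. 0) x"
    by (rule nn_cond_exp_F_meas) simp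
  moreover have "(\<lambda>x. ennreal (indicator B x)) = indicator B" "(\<lambda>x. ennreal (- indicator B x)) = (\<lambda>_. 0)"
    by (auto simp: fun_eq_iff indicator_def ennreal_neg)
  ultimately show ?thesis
    unfolding real_cond_exp_def
    by (elim AE_mp, intro AE_I2)
      (auto simp: top_unique less_top[symmetric] intro!: ennreal_enn2real[symmetric])
qed

text \<open>Pulling the \<open>G\<close>-measurable factor \<open>indicator D\<close> out of the
  conditional expectation leaves that of a \<open>G\<close>-measurable function, which is the
  function itself.\<close>

lemma real_cond_exp_eq_on_measurable:
  assumes P: "prob_space P" and G: "subalgebra P G" and D: "D \<in> sets G" and X: "integrable P X"
    and meas: "(\<lambda>\<omega>. X \<omega> * indicator D \<omega>) \<in> borel_measurable G"
  shows "AE \<omega> in P. \<omega> \<in> D \<longrightarrow> real_cond_exp P G X \<omega> = X \<omega>"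
proof -
  interpret prob_space P by (fact P)
  interpret G: finite_measure_subalgebra P G by unfold_locales (fact G)
  have DP: "D \<in> sets P" using D G by (auto simp: subalgebra_def)
  have int: "integrable P (\<lambda>\<omega>. indicator D \<omega> * X \<omega>)"
    using integrable_mult_indicator[OF DP X] by simp
  have "AE \<omega> in P. real_cond_exp P G (\<lambda>\<omega>. indicator D \<omega> * X \<omega>) \<omega> = indicator D \<omega> * real_cond_exp P G X \<omega>"
    using D X int by (intro G.real_cond_exp_mult) auto
  moreover have "AE \<omega> in P. real_cond_exp P G (\<lambda>\<omega>. indicator D \<omega> * X \<omega>) \<omega> = indicator D \<omega> * X \<omega>"
    using meas int by (intro G.real_cond_exp_F_meas) (simp_all add: mult.commute)
  ultimately show ?thesis by eventually_elim auto
qed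

text \<open>Bayes' formula. The quotient is \<open>H\<close>-measurable, and \<open>tr\<close> makes
  its product with \<open>indicator D\<close> measurable for \<open>G\<close>. By \<open>tr'\<close>
  a test set from \<open>G\<close> can be replaced on \<open>D\<close> by one from \<open>H\<close>,
  where the defining properties of numerator and denominator apply. In the application
  \<open>D\<close> is \<open>{T = n}\<close>, which in general does not belong to
  \<open>H = F (n - 1)\<close>.\<close>

lemma real_cond_exp_eq_on_trace:
  assumes P: "prob_space P" and G: "subalgebra P G" and H: "subalgebra P H"
    and D: "D \<in> sets G" and X: "integrable P X"
    and tr: "\<And>A. A \<in> sets H \<Longrightarrow> A \<inter> D \<in> sets G"
    and tr': "\<And>B. B \<in> sets G \<Longrightarrow> \<exists>A\<in>sets H. B \<inter> D = A \<inter> D"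
  shows "AE \<omega> in P. \<omega> \<in> D \<longrightarrow> real_cond_exp P G X \<omega> =
    real_cond_exp P H (\<lambda>\<omega>. X \<omega> * indicator D \<omega>) \<omega> / real_cond_exp P H (indicator D) \<omega>"
proof -
  interpret prob_space P by (fact P)
  interpret G: finite_measure_subalgebra P G by unfold_locales (fact G)
  interpret H: finite_measure_subalgebra P H by unfold_locales (fact H)
  define u where "u = real_cond_exp P H (\<lambda>\<omega>. X \<omega> * indicator D \<omega>)"
  define e where "e = real_cond_exp P H (indicator D)"
  define r where "r = (\<lambda>\<omega>. u \<omega> / e \<omega>)"
  have sp: "space G = space P" "space H = space P" using G H by (auto simp: subalgebra_def)
  have DP [measurable]: "D \<in> sets P" using D G by (auto simp: subalgebra_def)
  have Xm [measurable]: "X \<in> borel_measurable P" using X by simp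
  have uH [measurable]: "u \<in> borel_measurable H" and eH [measurable]: "e \<in> borel_measurable H"
    unfolding u_def e_def by auto
  have rH [measurable]: "r \<in> borel_measurable H" unfolding r_def by measurable
  have uP [measurable]: "u \<in> borel_measurable P" and eP [measurable]: "e \<in> borel_measurable P"
    and rP [measurable]: "r \<in> borel_measurable P"
    using uH eH rH H by (auto intro: measurable_from_subalg)
  have intXD: "integrable P (\<lambda>\<omega>. X \<omega> * indicator D \<omega>)"
    using integrable_mult_indicator[OF DP X] by (simp add: mult.commute)
  have intu: "integrable P u" unfolding u_def by (rule H.real_cond_exp_int(1)[OF intXD])
  have epos: "AE \<omega> in P. \<omega> \<in> D \<longrightarrow> 0 < e \<omega>"
    unfolding e_def by (rule cond_prob_pos[OF P H DP])
  have e0: "AE \<omega> in P. 0 \<le> e \<omega>"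
    unfolding e_def by (rule H.real_cond_exp_pos) auto

  \<comment> \<open>Since \<open>e\<close> may be arbitrarily small, \<open>r\<close> itself may
    fail to be integrable. Conditioning \<open>indicator D\<close> on \<open>H\<close> brings back
    the factor \<open>e\<close>, and \<open>\<bar>r\<bar> * e\<close> is bounded by the integrable
    \<open>\<bar>u\<bar>\<close>.\<close>
  have intr: "integrable P (\<lambda>\<omega>. r \<omega> * indicator D \<omega>)"
  proof (rule integrableI_bounded)
    have "(\<integral>\<^sup>+\<omega>. ennreal (norm (r \<omega> * indicator D \<omega>)) \<partial>P) = (\<integral>\<^sup>+\<omega>. ennreal \<bar>r \<omega>\<bar> * indicator D \<omega> \<partial>P)"
      by (intro nn_integral_cong) (auto simp: indicator_def)
    also have "\<dots> = (\<integral>\<^sup>+\<omega>. ennreal \<bar>r \<omega>\<bar> * nn_cond_exp P H (indicator D) \<omega> \<partial>P)"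
      by (rule H.nn_cond_exp_intg[symmetric]) auto
    \<comment> \<open>Only an inequality is claimed: where \<open>e\<close> is 0, the convention
      \<open>x / 0 = 0\<close> makes the left side 0.\<close>
    also have "\<dots> \<le> (\<integral>\<^sup>+\<omega>. ennreal \<bar>u \<omega>\<bar> \<partial>P)"
    proof (rule nn_integral_mono_AE)
      show "AE \<omega> in P. ennreal \<bar>r \<omega>\<bar> * nn_cond_exp P H (indicator D) \<omega> \<le> ennreal \<bar>u \<omega>\<bar>"
        using H.nn_cond_exp_indicator[OF DP] e0
        by eventually_elim
          (auto simp: e_def[symmetric] r_def ennreal_mult[symmetric] abs_divide)
    qed
    also have "\<dots> < \<infinity>" using intu by (simp add: integrable_iff_bounded)
    finally show "(\<integral>\<^sup>+\<omega>. ennreal (norm (r \<omega> * indicator D \<omega>)) \<partial>P) < \<infinity>" .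
  qed auto

  have rG: "(\<lambda>\<omega>. r \<omega> * indicator D \<omega>) \<in> borel_measurable G"
    by (rule borel_measurable_mult_indicator_trace[OF rH _ D tr]) (auto simp: sp)

  have "AE \<omega> in P. real_cond_exp P G (\<lambda>\<omega>. X \<omega> * indicator D \<omega>) \<omega> = r \<omega> * indicator D \<omega>"
  proof (rule G.real_cond_exp_charact[OF _ intXD intr rG])
    fix B assume B: "B \<in> sets G"
    then obtain A where A [measurable]: "A \<in> sets H" and BA: "B \<inter> D = A \<inter> D" using tr' by blast
    \<comment> \<open>On \<open>C\<close> the identity \<open>u = r * e\<close> holds pointwise.
      Inside \<open>D\<close> the removed points form a null set by \<open>epos\<close>, and
      \<open>r\<close> is 0 there by the convention for division.\<close>
    define C where "C = A \<inter> {\<omega> \<in> space H. e \<omega> \<noteq> 0}"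
    have CH [measurable]: "C \<in> sets H" unfolding C_def by measurable
    have AP [measurable]: "A \<in> sets P" and CP [measurable]: "C \<in> sets P"
      using A CH H by (auto simp: subalgebra_def)
    have BP [measurable]: "B \<in> sets P" using B G by (auto simp: subalgebra_def)
    have intC: "integrable P (\<lambda>\<omega>. (indicator C \<omega> * r \<omega>) * indicator D \<omega>)"
      using integrable_mult_indicator[OF CP intr] by (simp add: mult.assoc)
    have "(\<integral>\<omega>\<in>B. X \<omega> * indicator D \<omega> \<partial>P) = (\<integral>\<omega>\<in>C. X \<omega> * indicator D \<omega> \<partial>P)"
      unfolding set_lebesgue_integral_def
    proof (rule integral_cong_AE)
      show "AE \<omega> in P. indicator B \<omega> *\<^sub>R (X \<omega> * indicator D \<omega>) = indicator C \<omega> *\<^sub>R (X \<omega> * indicator D \<omega>)"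
        using epos AE_space
        by eventually_elim (use BA in \<open>auto simp: C_def sp indicator_def\<close>)
    qed auto
    also have "\<dots> = (\<integral>\<omega>\<in>C. u \<omega> \<partial>P)"
      unfolding u_def by (rule H.real_cond_exp_intA[OF intXD CH])
    also have "\<dots> = (\<integral>\<omega>. (indicator C \<omega> * r \<omega>) * e \<omega> \<partial>P)"
      unfolding set_lebesgue_integral_def
      by (intro Bochner_Integration.integral_cong) (auto simp: C_def r_def indicator_def)
    also have "\<dots> = (\<integral>\<omega>. (indicator C \<omega> * r \<omega>) * indicator D \<omega> \<partial>P)"
      unfolding e_def by (rule H.real_cond_exp_intg(2)[OF intC]) auto
    also have "\<dots> = (\<integral>\<omega>\<in>B. r \<omega> * indicator D \<omega> \<partial>P)"
      unfolding set_lebesgue_integral_def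
      by (intro Bochner_Integration.integral_cong)
        (use BA in \<open>auto simp: C_def r_def sp indicator_def\<close>)
    finally show "(\<integral>\<omega>\<in>B. X \<omega> * indicator D \<omega> \<partial>P) = (\<integral>\<omega>\<in>B. r \<omega> * indicator D \<omega> \<partial>P)" .
  qed
  moreover have "AE \<omega> in P. real_cond_exp P G (\<lambda>\<omega>. indicator D \<omega> * X \<omega>) \<omega> = indicator D \<omega> * real_cond_exp P G X \<omega>"
    using D intXD by (intro G.real_cond_exp_mult) (auto simp: mult.commute)
  ultimately show ?thesis
    unfolding u_def[symmetric] e_def[symmetric]
    by eventually_elim (auto simp: r_def mult.commute)
qed

section \<open>The \<open>\<sigma>\<close>-algebra of the strict past\<close>

context
  fixes \<Omega> :: "'a set" and F :: "nat \<Rightarrow> 'a measure" and T :: "'a \<Rightarrow> enat"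
  assumes filt: "filtration \<Omega> F"
begin

lemma strict_past_generator_subset:
  "sets (F 0) \<union> {A \<inter> {\<omega> \<in> \<Omega>. enat n < T \<omega>} | A n. A \<in> sets (F n)} \<subseteq> Pow \<Omega>"
  using filtration.space_F[OF filt] sets.sets_into_space by fastforce

lemma space_strict_past: "space (strict_past \<Omega> F T) = \<Omega>"
  unfolding strict_past_def by (rule space_measure_of[OF strict_past_generator_subset])

lemma sets_strict_past: "sets (strict_past \<Omega> F T) =
  sigma_sets \<Omega> (sets (F 0) \<union> {A \<inter> {\<omega> \<in> \<Omega>. enat n < T \<omega>} | A n. A \<in> sets (F n)})"
  unfolding strict_past_def by (rule sets_measure_of[OF strict_past_generator_subset])

lemma F0_in_strict_past: "A \<in> sets (F 0) \<Longrightarrow> A \<in> sets (strict_past \<Omega> F T)"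
  unfolding sets_strict_past by (rule sigma_sets.Basic) blast

lemma Int_less_in_strict_past:
  "A \<in> sets (F n) \<Longrightarrow> A \<inter> {\<omega> \<in> \<Omega>. enat n < T \<omega>} \<in> sets (strict_past \<Omega> F T)"
  unfolding sets_strict_past by (rule sigma_sets.Basic) blast

lemma less_in_strict_past: "{\<omega> \<in> \<Omega>. enat n < T \<omega>} \<in> sets (strict_past \<Omega> F T)"
proof -
  have "\<Omega> \<in> sets (F n)" using sets.top[of "F n"] filtration.space_F[OF filt] by simp
  then show ?thesis using Int_less_in_strict_past by (fastforce simp: Int_def)
qed

lemma eq_in_strict_past: "{\<omega> \<in> \<Omega>. T \<omega> = t} \<in> sets (strict_past \<Omega> F T)"
proof (cases t)
  case infinity
  have "{\<omega> \<in> \<Omega>. T \<omega> = t} = (\<Inter>n. {\<omega> \<in> \<Omega>. enat n < T \<omega>})"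
    unfolding infinity by (auto) (metis enat_iless less_irrefl neq_iff not_infinity_eq)
  also have "\<dots> \<in> sets (strict_past \<Omega> F T)"
    by (rule sets.countable_INT) (use less_in_strict_past in auto)
  finally show ?thesis .
next
  case (enat n)
  show ?thesis
  proof (cases n)
    case 0
    have "{\<omega> \<in> \<Omega>. T \<omega> = t} = space (strict_past \<Omega> F T) - {\<omega> \<in> \<Omega>. enat 0 < T \<omega>}"
      unfolding space_strict_past enat 0 by (auto simp: zero_enat_def[symmetric])
    then show ?thesis using less_in_strict_past by auto
  next
    case (Suc m)
    have "{\<omega> \<in> \<Omega>. T \<omega> = t} = {\<omega> \<in> \<Omega>. enat m < T \<omega>} - {\<omega> \<in> \<Omega>. enat (Suc m) < T \<omega>}"
      unfolding enat Suc
      by (auto simp: not_less) (metis Suc_ile_eq antisym)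
    then show ?thesis using less_in_strict_past by auto
  qed
qed

text \<open>\<open>{T = n + 1}\<close> lies inside \<open>{n < T}\<close>, so a generator of the
  strict past can be cut down to it. This is the source of the index shift to
  \<open>F (n - 1)\<close> in the final formula.\<close>

lemma Int_eq_enat_in_strict_past:
  assumes "A \<in> sets (F n)"
  shows "A \<inter> {\<omega> \<in> \<Omega>. T \<omega> = enat (Suc n)} \<in> sets (strict_past \<Omega> F T)"
proof -
  have "A \<inter> {\<omega> \<in> \<Omega>. T \<omega> = enat (Suc n)} = (A \<inter> {\<omega> \<in> \<Omega>. enat n < T \<omega>}) \<inter> {\<omega> \<in> \<Omega>. T \<omega> = enat (Suc n)}"
    by auto
  then show ?thesis using Int_less_in_strict_past[OF assms] eq_in_strict_past by auto
qed

text \<open>\<open>{T = \<infinity>}\<close> lies inside every \<open>{n < T}\<close>, which settles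
  the sets of each \<open>F n\<close>; the property then passes to complements and countable
  unions.\<close>

lemma Int_eq_infinity_in_strict_past:
  assumes "A \<in> sigma_sets \<Omega> (\<Union>n. sets (F n))"
  shows "A \<inter> {\<omega> \<in> \<Omega>. T \<omega> = \<infinity>} \<in> sets (strict_past \<Omega> F T)"
  using assms
proof induction
  case (Basic A)
  then obtain n where "A \<in> sets (F n)" by auto
  moreover have "A \<inter> {\<omega> \<in> \<Omega>. T \<omega> = \<infinity>} = (A \<inter> {\<omega> \<in> \<Omega>. enat n < T \<omega>}) \<inter> {\<omega> \<in> \<Omega>. T \<omega> = \<infinity>}"
    by auto
  ultimately show ?case using Int_less_in_strict_past eq_in_strict_past by auto
next
  case (Compl A)
  have "(\<Omega> - A) \<inter> {\<omega> \<in> \<Omega>. T \<omega> = \<infinity>} = {\<omega> \<in> \<Omega>. T \<omega> = \<infinity>} - A \<inter> {\<omega> \<in> \<Omega>. T \<omega> = \<infinity>}"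
    by auto
  then show ?case using Compl.IH eq_in_strict_past by auto
next
  case (Union A)
  have "(\<Union>i. A i) \<inter> {\<omega> \<in> \<Omega>. T \<omega> = \<infinity>} = (\<Union>i. A i \<inter> {\<omega> \<in> \<Omega>. T \<omega> = \<infinity>})" by auto
  also have "\<dots> \<in> sets (strict_past \<Omega> F T)" by (rule sets.countable_UN) (use Union.IH in auto)
  finally show ?case .
qed simp

text \<open>The sets \<open>B\<close> with this property form a \<open>\<sigma>\<close>-algebra, so
  generators suffice. For \<open>m \<le> n\<close> the set \<open>{m < T}\<close> contains
  \<open>{T = n + 1}\<close> and \<open>A\<close> is already in \<open>F n\<close>; for
  \<open>m > n\<close> the two are disjoint and the empty set serves.\<close>

lemma strict_past_Int_eq_enat:
  assumes "B \<in> sets (strict_past \<Omega> F T)"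
  shows "\<exists>A\<in>sets (F n). B \<inter> {\<omega> \<in> \<Omega>. T \<omega> = enat (Suc n)} = A \<inter> {\<omega> \<in> \<Omega>. T \<omega> = enat (Suc n)}"
  using assms unfolding sets_strict_past
proof induction
  case (Basic B)
  then consider "B \<in> sets (F 0)" | A m where "B = A \<inter> {\<omega> \<in> \<Omega>. enat m < T \<omega>}" "A \<in> sets (F m)" by auto
  then show ?case
  proof cases
    case 1
    then show ?thesis using filtration.sets_F_mono[OF filt, of 0 n] by auto
  next
    case (2 A m)
    show ?thesis
    proof (cases "m \<le> n")
      case True
      then have "A \<in> sets (F n)" using 2 filtration.sets_F_mono[OF filt, of m n] by auto
      moreover have "B \<inter> {\<omega> \<in> \<Omega>. T \<omega> = enat (Suc n)} = A \<inter> {\<omega> \<in> \<Omega>. T \<omega> = enat (Suc n)}"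
        using True 2 by auto
      ultimately show ?thesis by blast
    next
      case False
      then have "B \<inter> {\<omega> \<in> \<Omega>. T \<omega> = enat (Suc n)} = {} \<inter> {\<omega> \<in> \<Omega>. T \<omega> = enat (Suc n)}"
        using 2 by auto
      then show ?thesis by blast
    qed
  qed
next
  case Empty
  show ?case by blast
next
  case (Compl B)
  then obtain A where "A \<in> sets (F n)" "B \<inter> {\<omega> \<in> \<Omega>. T \<omega> = enat (Suc n)} = A \<inter> {\<omega> \<in> \<Omega>. T \<omega> = enat (Suc n)}"
    by blast
  then show ?case
    using filtration.space_F[OF filt, of n] sets.compl_sets[of A "F n"]
    by (intro bexI[of _ "space (F n) - A"]) auto
next
  case (Union B)
  then have "\<forall>i. \<exists>A. A \<in> sets (F n) \<and>
      B i \<inter> {\<omega> \<in> \<Omega>. T \<omega> = enat (Suc n)} = A \<inter> {\<omega> \<in> \<Omega>. T \<omega> = enat (Suc n)}"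
    by blast
  from choice[OF this] obtain A where A: "\<And>i. A i \<in> sets (F n)"
    and BA: "\<And>i. B i \<inter> {\<omega> \<in> \<Omega>. T \<omega> = enat (Suc n)} = A i \<inter> {\<omega> \<in> \<Omega>. T \<omega> = enat (Suc n)}"
    by blast
  show ?case
  proof (rule bexI)
    show "(\<Union>i. B i) \<inter> {\<omega> \<in> \<Omega>. T \<omega> = enat (Suc n)} = (\<Union>i. A i) \<inter> {\<omega> \<in> \<Omega>. T \<omega> = enat (Suc n)}"
      unfolding Int_UN_distrib2 UN_extend_simps(4) BA ..
    show "(\<Union>i. A i) \<in> sets (F n)" using A by (intro sets.countable_UN) auto
  qed
qed

section \<open>Level sets of a stopping time\<close>

lemma stopping_time_extended_filtration_less:
  assumes "stopping_time (extended_filtration \<Omega> F) T"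
  shows "{\<omega> \<in> \<Omega>. enat n < T \<omega>} \<in> sets (F n)"
  using stopping_timeD2[OF assms, of "enat n"] filtration.space_F[OF filt]
  by (simp add: extended_filtration_def pred_def)

lemma stopping_time_extended_filtration_eq:
  assumes "stopping_time (extended_filtration \<Omega> F) T"
  shows "{\<omega> \<in> \<Omega>. T \<omega> = enat n} \<in> sets (F n)"
proof -
  have n: "{\<omega> \<in> \<Omega>. enat n < T \<omega>} \<in> sets (F n)"
    by (rule stopping_time_extended_filtration_less[OF assms])
  show ?thesis
  proof (cases n)
    case 0
    have "{\<omega> \<in> \<Omega>. T \<omega> = enat n} = space (F n) - {\<omega> \<in> \<Omega>. enat n < T \<omega>}"
      unfolding filtration.space_F[OF filt] 0 by (auto simp: zero_enat_def[symmetric])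
    then show ?thesis using n by auto
  next
    case (Suc m)
    have "{\<omega> \<in> \<Omega>. T \<omega> = enat n} = {\<omega> \<in> \<Omega>. enat m < T \<omega>} - {\<omega> \<in> \<Omega>. enat n < T \<omega>}"
      unfolding Suc by (auto simp: not_less) (metis Suc_ile_eq antisym)
    moreover have "{\<omega> \<in> \<Omega>. enat m < T \<omega>} \<in> sets (F n)"
      using stopping_time_extended_filtration_less[OF assms, of m]
        filtration.sets_F_mono[OF filt, of m n] Suc by auto
    ultimately show ?thesis using n by auto
  qed
qed

text \<open>The stopping time property puts \<open>{n < T}\<close> into \<open>F n\<close>, hence
  every generator of the strict past is an event of \<open>P\<close>.\<close>

lemma subalgebra_strict_past:
  assumes sp: "space P = \<Omega>" and sub: "\<And>n. sets (F n) \<subseteq> sets P"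
    and T: "stopping_time (extended_filtration \<Omega> F) T"
  shows "subalgebra P (strict_past \<Omega> F T)"
proof -
  have "sets (F 0) \<union> {A \<inter> {\<omega> \<in> \<Omega>. enat n < T \<omega>} | A n. A \<in> sets (F n)} \<subseteq> sets P"
    using sub stopping_time_extended_filtration_less[OF T] by blast
  then have "sets (strict_past \<Omega> F T) \<subseteq> sets P"
    using sets.sigma_sets_subset[of _ P] by (simp only: sets_strict_past sp)
  then show ?thesis by (simp add: subalgebra_def space_strict_past sp)
qed

end

section \<open>The density process at a stopping time\<close>

text \<open>Finiteness of \<open>N\<close> makes the derivative finite almost everywhere, so
  \<open>enn2real\<close> loses nothing. The absolute value is there because an arbitrary version
  \<open>f\<close> may be negative on a null set.\<close>

lemma nn_integral_RN_deriv_version: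
  fixes f :: "'a \<Rightarrow> real"
  assumes M: "finite_measure M" and N: "finite_measure N" and ac: "absolutely_continuous M N"
    and sets: "sets N = sets M" and A: "A \<in> sets M"
    and f: "AE x in M. f x = enn2real (RN_deriv M N x)"
  shows "(\<integral>\<^sup>+x. ennreal \<bar>f x\<bar> * indicator A x \<partial>M) = emeasure N A"
proof -
  interpret M: finite_measure M by (fact M)
  interpret N: finite_measure N by (fact N)
  have fin: "AE x in M. RN_deriv M N x \<noteq> \<infinity>"
    by (rule M.RN_deriv_finite[OF _ ac sets]) unfold_locales
  have "(\<integral>\<^sup>+x. ennreal \<bar>f x\<bar> * indicator A x \<partial>M) = (\<integral>\<^sup>+x. RN_deriv M N x * indicator A x \<partial>M)"
    by (rule nn_integral_cong_AE) (use f fin in eventually_elim, auto simp: less_top)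
  also have "\<dots> = emeasure (density M (RN_deriv M N)) A"
    using A by (simp add: emeasure_density)
  also have "\<dots> = emeasure N A" by (simp add: M.density_RN_deriv[OF ac sets])
  finally show ?thesis .
qed

text \<open>The null sets of a restriction are the null sets that lie in \<open>G\<close>, so
  absolute continuity is inherited. For a \<open>G\<close>-measurable integrand the restricted and
  the full measure give the same integral.\<close>

lemma nn_integral_RN_deriv_restr_version:
  fixes f :: "'a \<Rightarrow> real"
  assumes M: "finite_measure M" and N: "finite_measure N" and ac: "absolutely_continuous M N"
    and sets: "sets N = sets M" and G: "subalgebra M G" and A: "A \<in> sets G"
    and fG: "f \<in> borel_measurable G"
    and f: "AE x in restr_to_subalg M G. f x = enn2real (RN_deriv (restr_to_subalg M G) (restr_to_subalg N G) x)"
  shows "(\<integral>\<^sup>+x. ennreal \<bar>f x\<bar> * indicator A x \<partial>M) = emeasure N A"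
proof -
  have G': "subalgebra N G" using G sets sets_eq_imp_space_eq[OF sets] by (simp add: subalgebra_def)
  have "absolutely_continuous (restr_to_subalg M G) (restr_to_subalg N G)"
    using ac by (auto simp: absolutely_continuous_def null_sets_restr_to_subalg[OF G] null_sets_restr_to_subalg[OF G'])
  then have "(\<integral>\<^sup>+x. ennreal \<bar>f x\<bar> * indicator A x \<partial>restr_to_subalg M G) = emeasure (restr_to_subalg N G) A"
    using finite_measure_restr_to_subalg[OF G M] finite_measure_restr_to_subalg[OF G' N] A f
    by (intro nn_integral_RN_deriv_version) (auto simp: sets_restr_to_subalg G G')
  moreover have "(\<integral>\<^sup>+x. ennreal \<bar>f x\<bar> * indicator A x \<partial>restr_to_subalg M G) = (\<integral>\<^sup>+x. ennreal \<bar>f x\<bar> * indicator A x \<partial>M)"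
    using fG A by (intro nn_integral_subalgebra2[OF G]) auto
  ultimately show ?thesis by (simp add: emeasure_restr_to_subalg[OF G' A])
qed

lemma integrable_density_process_at_stopping_time:
  fixes T :: "'a \<Rightarrow> enat"
  assumes P: "prob_space P" and \<mu>: "prob_space \<mu>" and sets: "sets \<mu> = sets P"
    and filt: "filtration (space P) F" and sub: "\<And>n. sets (F n) \<subseteq> sets P"
    and ac: "absolutely_continuous P \<mu>" and z: "density_process P \<mu> F z"
    and T: "stopping_time (extended_filtration (space P) F) T"
  shows "integrable P (\<lambda>\<omega>. z (T \<omega>) \<omega>)"
proof -
  interpret P: prob_space P by (fact P)
  interpret \<mu>: prob_space \<mu> by (fact \<mu>)
  have subF: "subalgebra P (F n)" for n
    using sub filtration.space_F[OF filt] by (simp add: subalgebra_def)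
  let ?D = "\<lambda>t. {\<omega> \<in> space P. T \<omega> = t}"
  have D [measurable]: "?D t \<in> sets P" for t
    using eq_in_strict_past[OF filt, of T t] subalgebra_strict_past[OF filt refl sub T]
    by (auto simp: subalgebra_def)
  have zm [measurable]: "z t \<in> borel_measurable P" for t
  proof (cases t)
    case (enat n)
    then show ?thesis
      using z measurable_from_subalg[OF subF] unfolding density_process_def by auto
  qed (use z in \<open>auto simp: density_process_def\<close>)
  have Tm: "T \<in> measurable P (count_space UNIV)"
    unfolding measurable_count_space_eq2_countable
    using D by (auto simp: vimage_def Int_def conj_commute)
  \<comment> \<open>For finite \<open>t = n\<close> the density on \<open>F n\<close> may be used
    because \<open>{T = n}\<close> is in \<open>F n\<close>; for \<open>t = \<infinity>\<close> it
    is the density on the whole \<open>\<sigma>\<close>-algebra.\<close>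
  have nz: "(\<integral>\<^sup>+\<omega>. ennreal \<bar>z t \<omega>\<bar> * indicator (?D t) \<omega> \<partial>P) = emeasure \<mu> (?D t)" for t
  proof (cases t)
    case (enat n)
    show ?thesis
      using z stopping_time_extended_filtration_eq[OF filt T, of n] unfolding density_process_def enat
      by (intro nn_integral_RN_deriv_restr_version[OF P.finite_measure_axioms \<mu>.finite_measure_axioms ac sets subF]) auto
  next
    case infinity
    show ?thesis
      using z unfolding density_process_def infinity
      by (intro nn_integral_RN_deriv_version[OF P.finite_measure_axioms \<mu>.finite_measure_axioms ac sets D]) auto
  qed
  show ?thesis
  proof (rule integrableI_bounded)
    show "(\<lambda>\<omega>. z (T \<omega>) \<omega>) \<in> borel_measurable P"
      by (rule measurable_compose_countable[OF zm Tm])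
    \<comment> \<open>At each point only the summand belonging to the value of \<open>T\<close> is
      nonzero.\<close>
    have "(\<integral>\<^sup>+\<omega>. ennreal (norm (z (T \<omega>) \<omega>)) \<partial>P) \<le>
      (\<integral>\<^sup>+\<omega>. (\<Sum>n. ennreal \<bar>z (enat n) \<omega>\<bar> * indicator (?D (enat n)) \<omega>) + ennreal \<bar>z \<infinity> \<omega>\<bar> * indicator (?D \<infinity>) \<omega> \<partial>P)"
    proof (rule nn_integral_mono)
      fix \<omega> assume \<omega>: "\<omega> \<in> space P"
      let ?f = "\<lambda>n. ennreal \<bar>z (enat n) \<omega>\<bar> * indicator (?D (enat n)) \<omega>"
      show "ennreal (norm (z (T \<omega>) \<omega>)) \<le> (\<Sum>n. ?f n) + ennreal \<bar>z \<infinity> \<omega>\<bar> * indicator (?D \<infinity>) \<omega>"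
      proof (cases "T \<omega>")
        case (enat n)
        then have "ennreal (norm (z (T \<omega>) \<omega>)) = sum ?f {n}" using \<omega> by simp
        also have "\<dots> \<le> (\<Sum>n. ?f n)" by (rule sum_le_suminf) auto
        finally show ?thesis by (rule order_trans) simp
      qed (use \<omega> in auto)
    qed
    also have "\<dots> = (\<Sum>n. emeasure \<mu> (?D (enat n))) + emeasure \<mu> (?D \<infinity>)"
      by (simp add: nn_integral_add nn_integral_suminf nz)
    also have "(\<Sum>n. emeasure \<mu> (?D (enat n))) = emeasure \<mu> (\<Union>n. ?D (enat n))"
      using D by (intro suminf_emeasure) (auto simp: sets disjoint_family_on_def)
    also have "emeasure \<mu> (\<Union>n. ?D (enat n)) + emeasure \<mu> (?D \<infinity>) < \<infinity>"
      by (simp add: \<mu>.emeasure_eq_measure flip: ennreal_plus)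
    finally show "(\<integral>\<^sup>+\<omega>. ennreal (norm (z (T \<omega>) \<omega>)) \<partial>P) < \<infinity>" .
  qed
qed

theorem theorem5:
  fixes P \<mu> :: "'a measure" and F :: "nat \<Rightarrow> 'a measure"
    and z :: "enat \<Rightarrow> 'a \<Rightarrow> real" and T :: "'a \<Rightarrow> enat"
  assumes "prob_space P" and "prob_space \<mu>" and "sets \<mu> = sets P"
    and "filtration (space P) F"
    and "sets P = sigma_sets (space P) (\<Union>n. sets (F n))"
    and "absolutely_continuous P \<mu>"
    and "density_process P \<mu> F z"
    and "stopping_time (extended_filtration (space P) F) T"
  shows "AE \<omega> in P.
    ((T \<omega> = 0 \<or> T \<omega> = \<infinity>) \<longrightarrow>
      real_cond_exp P (strict_past (space P) F T) (\<lambda>\<omega>. z (T \<omega>) \<omega>) \<omega> = z (T \<omega>) \<omega>) \<and>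
    (\<forall>n\<ge>1. T \<omega> = enat n \<longrightarrow>
      real_cond_exp P (strict_past (space P) F T) (\<lambda>\<omega>. z (T \<omega>) \<omega>) \<omega> =
        real_cond_exp P (F (n - 1)) (\<lambda>\<omega>. z (enat n) \<omega> * indicator {\<omega> \<in> space P. T \<omega> = enat n} \<omega>) \<omega> /
        real_cond_exp P (F (n - 1)) (indicator {\<omega> \<in> space P. T \<omega> = enat n}) \<omega>)"
proof -
  note filt = assms(4)
  let ?G = "strict_past (space P) F T"
  let ?D = "\<lambda>t. {\<omega> \<in> space P. T \<omega> = t}"
  let ?X = "\<lambda>\<omega>. z (T \<omega>) \<omega>"
  have sub: "sets (F n) \<subseteq> sets P" for n
    unfolding assms(5) by (auto intro: sigma_sets.Basic)
  have subF: "subalgebra P (F n)" for n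
    using sub filtration.space_F[OF filt] by (simp add: subalgebra_def)
  have G: "subalgebra P ?G" by (rule subalgebra_strict_past[OF filt refl sub assms(8)])
  have D: "?D t \<in> sets ?G" for t by (rule eq_in_strict_past[OF filt])
  have X: "integrable P ?X"
    by (rule integrable_density_process_at_stopping_time[OF assms(1-4) sub assms(6-8)])
  \<comment> \<open>Restricting to a level set of \<open>T\<close> freezes the random index.\<close>
  have XD: "(\<lambda>\<omega>. ?X \<omega> * indicator (?D t) \<omega>) = (\<lambda>\<omega>. z t \<omega> * indicator (?D t) \<omega>)" for t
    by (auto simp: indicator_def)
  have zero: "AE \<omega> in P. \<omega> \<in> ?D 0 \<longrightarrow> real_cond_exp P ?G ?X \<omega> = ?X \<omega>"
  proof (rule real_cond_exp_eq_on_measurable[OF assms(1) G D X], unfold XD)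
    show "(\<lambda>\<omega>. z 0 \<omega> * indicator (?D 0) \<omega>) \<in> borel_measurable ?G"
    proof (rule borel_measurable_mult_indicator_trace[OF _ _ D])
      show "z 0 \<in> borel_measurable (F 0)"
        using assms(7) by (simp add: density_process_def zero_enat_def)
      show "A \<inter> ?D 0 \<in> sets ?G" if "A \<in> sets (F 0)" for A
        using F0_in_strict_past[OF filt that] D by auto
    qed (simp add: space_strict_past[OF filt] filtration.space_F[OF filt])
  qed
  \<comment> \<open>Here \<open>z \<infinity>\<close> is measurable only with respect to
    \<open>P\<close>. Its events have traces in the strict past because they are generated by the
    \<open>F n\<close>.\<close>
  have infty: "AE \<omega> in P. \<omega> \<in> ?D \<infinity> \<longrightarrow> real_cond_exp P ?G ?X \<omega> = ?X \<omega>"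
  proof (rule real_cond_exp_eq_on_measurable[OF assms(1) G D X], unfold XD)
    show "(\<lambda>\<omega>. z \<infinity> \<omega> * indicator (?D \<infinity>) \<omega>) \<in> borel_measurable ?G"
    proof (rule borel_measurable_mult_indicator_trace[OF _ _ D])
      show "z \<infinity> \<in> borel_measurable P"
        using assms(7) by (simp add: density_process_def)
      show "A \<inter> ?D \<infinity> \<in> sets ?G" if "A \<in> sets P" for A
        using that unfolding assms(5) by (rule Int_eq_infinity_in_strict_past[OF filt])
    qed (simp add: space_strict_past[OF filt])
  qed
  have "AE \<omega> in P. \<omega> \<in> ?D (enat (Suc m)) \<longrightarrow> real_cond_exp P ?G ?X \<omega> =
      real_cond_exp P (F m) (\<lambda>\<omega>. z (enat (Suc m)) \<omega> * indicator (?D (enat (Suc m))) \<omega>) \<omega> /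
      real_cond_exp P (F m) (indicator (?D (enat (Suc m)))) \<omega>" for m
    using real_cond_exp_eq_on_trace[OF assms(1) G subF D X
        Int_eq_enat_in_strict_past[OF filt] strict_past_Int_eq_enat[OF filt], of m]
    unfolding XD .
  \<comment> \<open>The countably many exceptional null sets are merged into one.\<close>
  then have "AE \<omega> in P. \<forall>m. \<omega> \<in> ?D (enat (Suc m)) \<longrightarrow> real_cond_exp P ?G ?X \<omega> =
      real_cond_exp P (F m) (\<lambda>\<omega>. z (enat (Suc m)) \<omega> * indicator (?D (enat (Suc m))) \<omega>) \<omega> /
      real_cond_exp P (F m) (indicator (?D (enat (Suc m)))) \<omega>"
    by (simp add: AE_all_countable)
  with zero infty show ?thesis
    using AE_space
  proof eventually_elim
    case (elim \<omega>)
    show ?case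
    proof (intro conjI impI allI)
      fix n :: nat assume "1 \<le> n" "T \<omega> = enat n"
      moreover then obtain m where "n = Suc m" by (cases n) auto
      ultimately show "real_cond_exp P ?G ?X \<omega> =
        real_cond_exp P (F (n - 1)) (\<lambda>\<omega>. z (enat n) \<omega> * indicator (?D (enat n)) \<omega>) \<omega> /
        real_cond_exp P (F (n - 1)) (indicator (?D (enat n))) \<omega>"
        using elim(3,4) by simp
    qed (use elim in auto)
  qed
qed

end
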